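(* Let $f,g\in C_0(\mathbb{R}^n)$ be non-negative functions, neither identically zero, and assume that there exists a finite regular non-negative Borel measure $\mu$ on $\mathbb{R}^n$ with $\mu*g\ge f$ everywhere on $\mathbb{R}^n$. Then $$M^{1}(f,g_-)=N^{1}(f,g).$$ Moreover, there exists a non-negative Borel measure $\mu_0$ on $\mathbb{R}^n$ with $\mu_0*g\ge f$ everywhere such that $\mu_0(\mathbb{R}^n)=N^{1}(f,g)$.
   Context: $C_0(\mathbb{R}^n)$ is the space of continuous real-valued functions on $\mathbb{R}^n$ vanishing at infinity. For a function $u$ on $\mathbb{R}^n$, $u_-(x)=u(-x)$. For a non-negative Borel measure $\mu$ and a Borel function $g\ge 0$, $(\mu*g)(x)=\int g(x-t)\,d\mu(t)$. For Borel measurable $f,g:\mathbb{R}^n\to[0,\infty)$ define $$N^1(f,g)=\inf\{\mu(\mathbb{R}^n):\ \mu*g\ge f \text{ everywhere on }\mathbb{R}^n\},\qquad M^1(f,g)=\sup\Big\{\int f\,d\rho:\ \rho*g\le 1\text{ everywhere on }\mathbb{R}^n\Big\},$$ where the infimum and supremum are over all non-negative Borel measures on $\mathbb{R}^n$ (with $\inf\emptyset=+\infty$). *)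

theory Defs
  imports "HOL-Analysis.Analysis"
begin

definition C0 :: "('a::euclidean_space \<Rightarrow> real) set" where
  "C0 = {u. continuous_on UNIV u \<and> (u \<longlongrightarrow> 0) at_infinity}"

definition reflect :: "('a::euclidean_space \<Rightarrow> real) \<Rightarrow> 'a \<Rightarrow> real" where
  "reflect u = (\<lambda>x. u (- x))"

(* Arbitrary Borel measures: neither finiteness nor sigma-finiteness is imposed. *)
definition borel_measures :: "'a::euclidean_space measure set" where
  "borel_measures = {\<mu>. sets \<mu> = sets borel}"

definition regular_measure :: "'a::euclidean_space measure \<Rightarrow> bool" where
  "regular_measure \<mu> \<longleftrightarrow>
     (\<forall>A \<in> sets borel.
        emeasure \<mu> A = (SUP K \<in> {K. compact K \<and> K \<subseteq> A}. emeasure \<mu> K) \<and>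
        emeasure \<mu> A = (INF U \<in> {U. open U \<and> A \<subseteq> U}. emeasure \<mu> U))"

(* The coercion ennreal sends negative reals to 0, so the following definitions have their
   intended meaning only for functions with values in [0, \<infinity>). *)
definition measure_conv ::
    "'a::euclidean_space measure \<Rightarrow> ('a \<Rightarrow> real) \<Rightarrow> 'a \<Rightarrow> ennreal" where
  "measure_conv \<mu> g x = (\<integral>\<^sup>+ t. ennreal (g (x - t)) \<partial>\<mu>)"

definition N1 :: "('a::euclidean_space \<Rightarrow> real) \<Rightarrow> ('a \<Rightarrow> real) \<Rightarrow> ennreal" where
  "N1 f g = (INF \<mu> \<in> {\<mu> \<in> borel_measures. \<forall>x. ennreal (f x) \<le> measure_conv \<mu> g x}.
               emeasure \<mu> UNIV)"

definition M1 :: "('a::euclidean_space \<Rightarrow> real) \<Rightarrow> ('a \<Rightarrow> real) \<Rightarrow> ennreal" where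
  "M1 f g = (SUP \<rho> \<in> {\<rho> \<in> borel_measures. \<forall>x. measure_conv \<rho> g x \<le> 1}.
               \<integral>\<^sup>+ x. ennreal (f x) \<partial>\<rho>)"

end

theory Submission
  imports Defs "HOL-Probability.Probability"
begin

text \<open>
  Tonelli's theorem gives \<open>M1 f (reflect g) \<le> N1 f g\<close>: an admissible \<open>\<rho>\<close> is finite on small balls,
  hence \<open>\<sigma>\<close>-finite. Conversely, if \<open>c > M1 f (reflect g)\<close> then on every finite set of points some
  discrete measure of mass \<open>c\<close> covers \<open>f\<close> up to an arbitrarily small error: otherwise the residuals
  of a nearly optimal covering would be weights of a discrete \<open>\<rho>\<close> with \<open>\<integral> f d\<rho> \<ge> c\<close>. Let the finite
  sets exhaust a countable dense set, \<open>c\<close> tend to \<open>M1 f (reflect g)\<close> and the errors tend to zero; a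
  vague limit of these coverings is a covering of mass at most \<open>M1 f (reflect g)\<close>, so it is optimal
  and both quantities agree.
\<close>

subsection \<open>A space-filling curve\<close>

text \<open>A clipped cosine in place of the usual piecewise linear function. It is continuous and
  2-periodic; clipping makes it constant 0 on \<open>{0..1/3}\<close> and constant 1 on
  \<open>{2/3..1}\<close>, since the cosine passes 1/2 and -1/2 at \<open>pi / 3\<close> and
  \<open>2 * pi / 3\<close>.\<close>

definition digit_wave :: "real \<Rightarrow> real" where
  "digit_wave t = max 0 (min 1 (1/2 - cos (pi * t)))"

text \<open>The Schoenberg curve. If \<open>t\<close> has ternary digits \<open>2 b\<^sub>k\<close> with every
  \<open>b\<^sub>k \<in> {0, 1}\<close>, then modulo 2 the number \<open>3 ^ k * t\<close> lies in \<open>{0..1/3}\<close> or in \<open>{2/3..1}\<close>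
  according to \<open>b\<^sub>k\<close>, so \<open>digit_wave (3 ^ k * t) = b\<^sub>k\<close>; the digits are dealt out cyclically to \<open>n\<close>
  coordinates.\<close>

definition schoenberg :: "nat \<Rightarrow> nat \<Rightarrow> real \<Rightarrow> real" where
  "schoenberg n j t = (\<Sum>i. digit_wave (3 ^ (n * i + j) * t) / 2 ^ Suc i)"

lemma digit_wave_bounds: "0 \<le> digit_wave t" "digit_wave t \<le> 1"
  by (auto simp: digit_wave_def)

lemma continuous_on_schoenberg: "continuous_on UNIV (schoenberg n j)"
proof -
  have sm: "summable (\<lambda>i. 1 / 2 ^ Suc i :: real)"
    using power_half_series sums_summable by (auto simp: power_divide)
  let ?S = "\<lambda>m t. \<Sum>i<m. digit_wave (3 ^ (n * i + j) * t) / 2 ^ Suc i"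
  have "uniform_limit UNIV ?S (\<lambda>t. \<Sum>i. digit_wave (3 ^ (n * i + j) * t) / 2 ^ Suc i) sequentially"
    by (rule Weierstrass_m_test[OF _ sm]) (simp add: abs_of_nonneg digit_wave_bounds divide_right_mono)
  then have lim: "uniform_limit UNIV ?S (schoenberg n j) sequentially"
    by (simp add: schoenberg_def[abs_def])
  have "continuous_on UNIV (?S m)" for m
    unfolding digit_wave_def by (intro continuous_intros) auto
  then show ?thesis
    by (intro uniform_limit_theorem[OF _ lim]) auto
qed

section \<open>Digit expansions and surjectivity of the curve\<close>

text \<open>Taking the parity of \<open>\<lfloor>2 ^ Suc i * a\<rfloor>\<close> as digit
  \<open>i\<close> makes the partial sums the dyadic truncations
  \<open>\<lfloor>2 ^ m * a\<rfloor> / 2 ^ m\<close>, which lie within \<open>(1 / 2) ^ m\<close> of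
  \<open>a\<close>. The bounds on \<open>a\<close> make the truncation for \<open>m = 0\<close>
  vanish.\<close>

lemma binary_expansion:
  fixes a :: real
  assumes "0 \<le> a" "a < 1"
  obtains b :: "nat \<Rightarrow> nat" where "\<And>i. b i \<in> {0, 1}" "(\<lambda>i. real (b i) / 2 ^ Suc i) sums a"
proof
  define b where "b i = nat (\<lfloor>2 ^ Suc i * a\<rfloor> mod 2)" for i
  show "b i \<in> {0, 1}" for i
    unfolding b_def by (auto simp: nat_eq_iff)
  have step: "\<lfloor>2 * x\<rfloor> = 2 * \<lfloor>x\<rfloor> + \<lfloor>2 * x\<rfloor> mod 2" for x :: real
    using floor_divide_real_eq_div[of 2 "2 * x"] by simp
  have part: "(\<Sum>i<m. real (b i) / 2 ^ Suc i) = of_int \<lfloor>2 ^ m * a\<rfloor> / 2 ^ m" for m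
  proof (induction m)
    case 0
    then show ?case using assms by (simp add: floor_eq_iff)
  next
    case (Suc m)
    have "real (b m) = of_int (\<lfloor>2 ^ Suc m * a\<rfloor> mod 2)"
      unfolding b_def by simp
    moreover have "of_int \<lfloor>2 ^ Suc m * a\<rfloor> = 2 * of_int \<lfloor>2 ^ m * a\<rfloor> + (of_int (\<lfloor>2 ^ Suc m * a\<rfloor> mod 2) :: real)"
      using arg_cong[OF step[of "2 ^ m * a"], of "of_int :: int \<Rightarrow> real"]
      by (simp only: of_int_add of_int_mult power_Suc mult.assoc of_int_numeral)
    ultimately show ?case using Suc by (simp add: field_simps)
  qed
  have "(\<lambda>m. of_int \<lfloor>2 ^ m * a\<rfloor> / 2 ^ m) \<longlonglongrightarrow> a"
  proof (rule tendsto_sandwich[of "\<lambda>m. a - (1 / 2) ^ m" _ _ "\<lambda>_. a"])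
    have "a - (1 / 2) ^ m \<le> of_int \<lfloor>2 ^ m * a\<rfloor> / 2 ^ m" for m
    proof -
      have "a - (1 / 2) ^ m = (2 ^ m * a - 1) / 2 ^ m"
        by (simp add: field_simps)
      also have "\<dots> \<le> of_int \<lfloor>2 ^ m * a\<rfloor> / 2 ^ m"
        by (intro divide_right_mono) (linarith, simp)
      finally show ?thesis .
    qed
    then show "\<forall>\<^sub>F m in sequentially. a - (1 / 2) ^ m \<le> of_int \<lfloor>2 ^ m * a\<rfloor> / 2 ^ m" by simp
    have "of_int \<lfloor>2 ^ m * a\<rfloor> / 2 ^ m \<le> a" for m
    proof -
      have "of_int \<lfloor>2 ^ m * a\<rfloor> \<le> 2 ^ m * a" by linarith
      then show ?thesis by (simp add: field_simps)
    qed
    then show "\<forall>\<^sub>F m in sequentially. of_int \<lfloor>2 ^ m * a\<rfloor> / 2 ^ m \<le> a" by simp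
    show "(\<lambda>m. a - (1 / 2) ^ m) \<longlonglongrightarrow> a"
      by (auto intro!: tendsto_eq_intros LIMSEQ_realpow_zero)
  qed auto
  then show "(\<lambda>i. real (b i) / 2 ^ Suc i) sums a"
    by (simp only: sums_def part)
qed

lemma digit_wave_even_shift: "digit_wave (2 * real N + y) = digit_wave y"
proof -
  have "cos (pi * (2 * real N + y)) = cos (pi * y + 2 * real N * pi)"
    by (simp add: algebra_simps)
  also have "\<dots> = cos (pi * y)"
    by (simp add: cos_add sin_add)
  finally show ?thesis by (simp add: digit_wave_def)
qed

lemma digit_wave_low:
  assumes "0 \<le> y" "y \<le> 1/3"
  shows "digit_wave y = 0"
proof -
  have "cos (pi / 3) \<le> cos (pi * y)"
    using assms pi_gt_zero by (intro cos_monotone_0_pi_le) (auto simp: field_simps)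
  then show ?thesis by (simp add: digit_wave_def cos_60)
qed

lemma digit_wave_high:
  assumes "2/3 \<le> y" "y \<le> 1"
  shows "digit_wave y = 1"
proof -
  have "cos (pi * y) \<le> cos (2 * pi / 3)"
    using assms pi_gt_zero by (intro cos_monotone_0_pi_le) (auto simp: field_simps)
  then show ?thesis by (simp add: digit_wave_def cos_120)
qed

text \<open>The tails \<open>R k\<close> of the ternary series satisfy
  \<open>3 * R k = 2 * b k + R (Suc k)\<close>, so \<open>3 ^ k * R 0\<close> differs from
  \<open>R k\<close> by an even integer, invisible to \<open>digit_wave\<close>. As
  \<open>R (Suc k)\<close> lies in \<open>{0..1}\<close>, \<open>R k\<close> lies in the lower or
  upper third according to \<open>b k\<close>.\<close>

lemma ternary_digits:
  fixes b :: "nat \<Rightarrow> nat"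
  assumes b: "\<And>i. b i \<in> {0, 1}"
  obtains t :: real where "t \<in> {0..1}" "\<And>k. digit_wave (3 ^ k * t) = b k"
proof
  define c where "c k i = 2 * real (b (i + k)) / 3 ^ Suc i" for k i
  define R where "R k = (\<Sum>i. c k i)" for k
  have geo: "(\<lambda>i. 2 / 3 ^ Suc i :: real) sums 1"
    using sums_mult[OF geometric_sums[of "1/3::real"], of "2/3"] by (simp add: power_divide)
  have c0: "0 \<le> c k i" and c1: "c k i \<le> 2 / 3 ^ Suc i" for k i
    using b[of "i + k"] by (auto simp: c_def)
  have smc: "summable (c k)" for k
    by (rule summable_comparison_test'[OF sums_summable[OF geo], of 0]) (use c0 c1 in auto)
  have R01: "0 \<le> R k" "R k \<le> 1" for k
    using suminf_nonneg[OF smc c0, of k] suminf_le[OF c1 smc sums_summable[OF geo], of k] sums_unique[OF geo]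
    by (auto simp: R_def)
  have rec: "3 * R k = 2 * real (b k) + R (Suc k)" for k
  proof -
    have "R k = c k 0 + (\<Sum>i. c k (Suc i))"
      unfolding R_def using suminf_split_head[OF smc, of k] by simp
    also have "(\<lambda>i. c k (Suc i)) = (\<lambda>i. c (Suc k) i / 3)"
      by (auto simp: c_def)
    also have "(\<Sum>i. c (Suc k) i / 3) = R (Suc k) / 3"
      unfolding R_def using suminf_divide[OF smc, of "Suc k" 3] by simp
    finally show ?thesis by (simp add: c_def)
  qed
  have ex: "\<exists>N. 3 ^ k * R 0 = 2 * real N + R k" for k
  proof (induction k)
    case 0
    show ?case by (auto intro: exI[of _ 0])
  next
    case (Suc k)
    then obtain N where "3 ^ k * R 0 = 2 * real N + R k" by blast
    then have "3 ^ Suc k * R 0 = 2 * real (3 * N + b k) + R (Suc k)"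
      using rec[of k] by simp
    then show ?case by blast
  qed
  show "R 0 \<in> {0..1}" using R01[of 0] by simp
  show "digit_wave (3 ^ k * R 0) = b k" for k
  proof -
    have "digit_wave (R k) = b k"
      using b[of k] rec[of k] R01[of "Suc k"] digit_wave_low[of "R k"] digit_wave_high[of "R k"] by auto
    then show ?thesis using ex[of k] digit_wave_even_shift by auto
  qed
qed

lemma schoenberg_onto:
  assumes "\<And>j. j < n \<Longrightarrow> 0 \<le> a j" "\<And>j. j < n \<Longrightarrow> a j < 1"
  obtains t where "t \<in> {0..1}" "\<And>j. j < n \<Longrightarrow> schoenberg n j t = a j"
proof -
  have "\<exists>b. (\<forall>i. b i \<in> {0, 1}) \<and> (\<lambda>i. real (b i :: nat) / 2 ^ Suc i) sums a j" if "j < n" for j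
    using binary_expansion[of "a j"] assms that by metis
  then obtain b where b: "\<And>j i. j < n \<Longrightarrow> b j i \<in> {0, 1::nat}"
    and s: "\<And>j. j < n \<Longrightarrow> (\<lambda>i. real (b j i) / 2 ^ Suc i) sums a j"
    by metis
  \<comment> \<open>The digit sequences are interleaved: \<open>k = n * i + j\<close> carries digit
    \<open>i\<close> of coordinate \<open>j\<close>. For \<open>n = 0\<close> nothing is known about
    \<open>b\<close>, and the value 0 keeps \<open>d\<close> a digit sequence.\<close>
  define d where "d k = (if n = 0 then 0 else b (k mod n) (k div n))" for k
  have "d i \<in> {0, 1}" for i
    using b[of "i mod n"] by (auto simp: d_def)
  then obtain t where t: "t \<in> {0..1}" "\<And>k. digit_wave (3 ^ k * t) = d k"
    using ternary_digits by blast
  have "schoenberg n j t = a j" if "j < n" for j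
    using that s[of j] sums_unique by (fastforce simp: schoenberg_def t d_def)
  then show ?thesis using that t by blast
qed

lemma space_filling_curve:
  obtains \<phi> :: "real \<Rightarrow> 'a::euclidean_space"
  where "continuous_on UNIV \<phi>" "\<And>y. norm y < 1 \<Longrightarrow> \<exists>t\<in>{0..1}. \<phi> t = y"
proof -
  obtain e :: "'a \<Rightarrow> nat" where e: "bij_betw e Basis {0..<DIM('a)}"
    using ex_bij_betw_finite_nat[OF finite_Basis] by blast
  \<comment> \<open>Rescaling the coordinates from \<open>[0, 1)\<close> to \<open>[-1, 1)\<close>
    gives a cube that contains the open unit ball.\<close>
  define \<phi> where "\<phi> t = (\<Sum>i\<in>Basis. (2 * schoenberg DIM('a) (e i) t - 1) *\<^sub>R i)" for t :: real
  have "continuous_on UNIV \<phi>"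
    unfolding \<phi>_def by (intro continuous_intros continuous_on_schoenberg)
  moreover have "\<exists>t\<in>{0..1}. \<phi> t = y" if y: "norm y < 1" for y :: 'a
  proof -
    define e' where "e' = the_inv_into Basis e"
    have e': "e' j \<in> Basis" if "j < DIM('a)" for j
      using bij_betw_the_inv_into[OF e] that by (auto simp: e'_def bij_betw_def)
    have e'e: "e' (e i) = i" "e i < DIM('a)" if "i \<in> Basis" for i
      using e that the_inv_into_f_f[of e Basis i] by (auto simp: e'_def bij_betw_def)
    have "\<bar>y \<bullet> i\<bar> < 1" if "i \<in> Basis" for i
      using y Basis_le_norm[OF that, of y] by linarith
    then have "0 \<le> (y \<bullet> e' j + 1) / 2" "(y \<bullet> e' j + 1) / 2 < 1" if "j < DIM('a)" for j
      using e'[OF that] by (force simp: abs_less_iff)+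
    then obtain t where t: "t \<in> {0..1}" "\<And>j. j < DIM('a) \<Longrightarrow> schoenberg DIM('a) j t = (y \<bullet> e' j + 1) / 2"
      using schoenberg_onto[of "DIM('a)" "\<lambda>j. (y \<bullet> e' j + 1) / 2"] by blast
    have "\<phi> t = (\<Sum>i\<in>Basis. (y \<bullet> i) *\<^sub>R i)"
      unfolding \<phi>_def by (intro sum.cong) (auto simp: t(2) e'e field_simps)
    then show ?thesis using t(1) euclidean_representation by metis
  qed
  ultimately show ?thesis using that by blast
qed

subsection \<open>Vague compactness\<close>

lemma C0_bounded:
  assumes "u \<in> C0"
  obtains B where "0 \<le> B" "\<And>x. \<bar>u x\<bar> \<le> B"
proof -
  have cont: "continuous_on UNIV u" and lim: "(u \<longlongrightarrow> 0) at_infinity"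
    using assms by (auto simp: C0_def)
  obtain b where b: "\<And>x. b \<le> norm x \<Longrightarrow> \<bar>u x\<bar> < 1"
    using tendstoD[OF lim, of 1] by (auto simp: eventually_at_infinity)
  have "bounded (u ` cball 0 b)"
    by (intro compact_imp_bounded compact_continuous_image continuous_on_subset[OF cont]) auto
  then obtain C where C: "\<And>x. norm x \<le> b \<Longrightarrow> \<bar>u x\<bar> \<le> C"
    unfolding bounded_iff by (metis image_eqI mem_cball_0 real_norm_def)
  show ?thesis
  proof
    show "\<bar>u x\<bar> \<le> max C 1" for x
      using b[of x] C[of x] by (cases "b \<le> norm x") auto
  qed auto
qed

lemma C0_translate_reflect:
  assumes "u \<in> C0"
  shows "(\<lambda>t. u (x - t)) \<in> C0"
proof -
  have cont: "continuous_on UNIV u" and lim: "(u \<longlongrightarrow> 0) at_infinity"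
    using assms by (auto simp: C0_def)
  have "filterlim (\<lambda>t. x - t) at_infinity at_infinity"
    by (subst filterlim_at_infinity_conv_norm_at_top)
       (rule filterlim_at_top_mono[of "\<lambda>t. norm t - norm x"],
        auto intro!: filterlim_tendsto_add_at_top[of "\<lambda>_. - norm x" _ _ norm, simplified]
          filterlim_norm_at_top eventuallyI simp: norm_minus_commute norm_triangle_ineq2)
  then have "((\<lambda>t. u (x - t)) \<longlongrightarrow> 0) at_infinity"
    by (rule filterlim_compose[OF lim])
  moreover have "continuous_on UNIV (\<lambda>t. u (x - t))"
    by (rule continuous_on_compose2[OF cont]) (auto intro!: continuous_intros)
  ultimately show ?thesis by (simp add: C0_def)
qed

section \<open>Radial compactification and vague limits\<close>

text \<open>The inverse of \<open>x / (1 + norm x)\<close>: on the open unit ball it is a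
  homeomorphism onto the whole space, with the unit sphere in the place of infinity.\<close>

definition unball :: "'a::real_normed_vector \<Rightarrow> 'a" where
  "unball y = y /\<^sub>R (1 - norm y)"

lemma unball_onto:
  obtains y where "norm y < 1" "unball y = x"
proof
  have p: "1 + norm x > 0" by (simp add: add_pos_nonneg)
  show "norm (x /\<^sub>R (1 + norm x)) < 1"
    using p by (simp add: field_simps)
  have "1 - norm (x /\<^sub>R (1 + norm x)) = inverse (1 + norm x)"
    using p by (simp add: field_simps)
  then show "unball (x /\<^sub>R (1 + norm x)) = x"
    using p by (simp add: unball_def)
qed

lemma continuous_on_unball: "continuous_on (ball 0 1) unball"
  unfolding unball_def by (intro continuous_intros) auto

text \<open>Near the unit sphere \<open>unball y\<close> escapes to infinity, where \<open>u\<close>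
  tends to 0, so the extension by zero has no jump.\<close>

lemma continuous_on_extend_unball:
  fixes u :: "'a::euclidean_space \<Rightarrow> real"
  assumes "u \<in> C0"
  shows "continuous_on UNIV (\<lambda>y. if norm y < 1 then u (unball y) else 0)" (is "continuous_on _ ?U")
proof -
  have cont: "continuous_on UNIV u" and lim: "(u \<longlongrightarrow> 0) at_infinity"
    using assms by (auto simp: C0_def)
  have "isCont ?U y" for y
  proof (cases "norm y < 1")
    case True
    have "continuous_on (ball 0 1) (\<lambda>y. u (unball y))"
      by (rule continuous_on_compose2[OF cont continuous_on_unball]) auto
    then have "continuous_on (ball 0 1) ?U"
      by (rule continuous_on_eq) auto
    then show ?thesis
      using True by (simp add: continuous_on_eq_continuous_at)
  next
    case False
    have "\<forall>\<^sub>F z in at y. dist (?U z) (?U y) < e" if "e > 0" for e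
    proof -
      obtain b where b: "\<And>x. b \<le> norm x \<Longrightarrow> \<bar>u x\<bar> < e"
        using tendstoD[OF lim \<open>e > 0\<close>] by (auto simp: eventually_at_infinity)
      \<comment> \<open>\<open>unball\<close> maps the sphere of radius \<open>R / (1 + R)\<close>
        to the sphere of radius \<open>R\<close>.\<close>
      define R where "R = max b 0"
      have "R / (1 + R) < 1"
        by (simp add: R_def divide_less_eq)
      then have "R / (1 + R) < norm y"
        using False by linarith
      then have "\<forall>\<^sub>F z in at y. R / (1 + R) < norm z"
        by (intro order_tendstoD(1)[OF tendsto_norm[OF tendsto_ident_at]])
      then show ?thesis
      proof eventually_elim
        case (elim z)
        have "\<bar>u (unball z)\<bar> < e" if "norm z < 1"
        proof (rule b)
          have "0 < 1 + R" by (simp add: R_def)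
          then have "R \<le> norm z / (1 - norm z)"
            using elim that by (simp add: field_simps)
          also have "\<dots> = norm (unball z)"
            using that by (simp add: unball_def field_simps)
          finally show "b \<le> norm (unball z)" by (simp add: R_def)
        qed
        then show ?case using False \<open>e > 0\<close> by (simp add: dist_real_def)
      qed
    qed
    then show ?thesis by (simp add: isCont_def tendsto_iff)
  qed
  then show ?thesis by (simp add: continuous_at_imp_continuous_on)
qed

lemma real_distribution_measure_pmf: "real_distribution (distr (measure_pmf p) borel (\<lambda>s::real. s))"
  by (intro real_distribution.intro prob_space.prob_space_distr)
     (auto simp: measure_pmf.prob_space_axioms real_distribution_axioms_def)

text \<open>Pulling the measures back to \<open>{0..1}\<close> along the space-filling curve reduces this to Helly
  selection on the line. Mass escaping to infinity ends up where the curve leaves the open unit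
  ball, and is discarded.\<close>

lemma vague_compactness_pmf:
  fixes p :: "nat \<Rightarrow> 'a::euclidean_space pmf"
  obtains r :: "nat \<Rightarrow> nat" and \<mu> :: "'a measure"
  where "strict_mono r" "sets \<mu> = sets borel" "emeasure \<mu> UNIV \<le> 1"
    "\<And>u. u \<in> C0 \<Longrightarrow> (\<lambda>k. measure_pmf.expectation (p (r k)) u) \<longlonglongrightarrow> integral\<^sup>L \<mu> u"
proof -
  obtain \<phi> :: "real \<Rightarrow> 'a" where \<phi>: "continuous_on UNIV \<phi>"
    and onto: "\<And>y. norm y < 1 \<Longrightarrow> \<exists>t\<in>{0..1}. \<phi> t = y"
    using space_filling_curve by blast
  \<comment> \<open>The section \<open>\<sigma>\<close> of the curve may be a bare choice function:
    every set is measurable for a \<open>pmf\<close>, so the discrete measures can be transported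
    along it.\<close>
  have "\<exists>s\<in>{0..1}. norm (\<phi> s) < 1 \<and> unball (\<phi> s) = x" for x
    by (rule unball_onto[of x]) (use onto in metis)
  then obtain \<sigma> where \<sigma>: "\<And>x. \<sigma> x \<in> {0..1}" "\<And>x. norm (\<phi> (\<sigma> x)) < 1" "\<And>x. unball (\<phi> (\<sigma> x)) = x"
    by metis
  define \<nu> where "\<nu> k = distr (measure_pmf (map_pmf \<sigma> (p k))) borel (\<lambda>s. s)" for k
  have "tight \<nu>"
    unfolding tight_def
  proof (intro conjI allI impI exI)
    show "real_distribution (\<nu> n)" for n
      unfolding \<nu>_def by (rule real_distribution_measure_pmf)
    show "(-1::real) < 1" by simp
    show "1 - e < measure (\<nu> n) {-1<..1}" if "e > 0" for e n
    proof -
      have "\<sigma> -` {-1<..1} = UNIV"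
        using \<sigma>(1) by (auto simp: set_eq_iff intro: less_le_trans[of "-1" 0])
      then show ?thesis
        using that by (simp add: \<nu>_def measure_distr)
    qed
  qed
  then obtain r N where r: "strict_mono r" and N: "real_distribution N"
    and conv: "weak_conv_m (\<nu> \<circ> id \<circ> r) N"
    using tight_imp_convergent_subsubsequence[of \<nu> id] strict_mono_id by blast
  interpret N: real_distribution N by fact
  define A where "A = {s. norm (\<phi> s) < 1}"
  \<comment> \<open>The default value 0 is never charged, because \<open>\<mu>\<close> carries only
    the part of \<open>N\<close> on \<open>A\<close>.\<close>
  define T where "T s = (if s \<in> A then unball (\<phi> s) else 0)" for s
  have \<phi>m: "\<phi> \<in> borel_measurable borel"
    using \<phi> by (rule borel_measurable_continuous_onI)
  have A: "A \<in> sets borel"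
    unfolding A_def using \<phi>m by measurable
  have T: "T \<in> borel_measurable borel"
    unfolding T_def unball_def using \<phi>m A by measurable
  define \<mu> where "\<mu> = distr (density N (indicator A)) borel T"
  have TN: "T \<in> measurable (density N (indicator A)) borel"
    using T by simp
  show ?thesis
  proof
    show "strict_mono r" by fact
    show "sets \<mu> = sets borel" by (simp add: \<mu>_def)
    have "emeasure \<mu> UNIV = emeasure (density N (indicator A)) UNIV"
      unfolding \<mu>_def using TN by (subst emeasure_distr) auto
    also have "\<dots> = emeasure N A"
      using A by (subst emeasure_density) auto
    finally show "emeasure \<mu> UNIV \<le> 1"
      using N.emeasure_le_1 by simp
  next
    fix u :: "'a \<Rightarrow> real" assume u: "u \<in> C0"
    \<comment> \<open>This test function on the line is continuous, restores \<open>u x\<close> at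
      \<open>\<sigma> x\<close>, and vanishes off \<open>A\<close>. Weak convergence tested on
      \<open>h\<close> is therefore convergence of the integrals of \<open>u\<close>.\<close>
    define h where "h s = (if norm (\<phi> s) < 1 then u (unball (\<phi> s)) else 0)" for s
    have um: "u \<in> borel_measurable borel"
      using u by (auto simp: C0_def intro: borel_measurable_continuous_onI)
    have hc: "continuous_on UNIV h"
      unfolding h_def using continuous_on_compose2[OF continuous_on_extend_unball[OF u] \<phi>] by auto
    obtain B where B: "0 \<le> B" "\<And>x. \<bar>u x\<bar> \<le> B"
      using C0_bounded[OF u] by blast
    have "(\<lambda>k. integral\<^sup>L ((\<nu> \<circ> id \<circ> r) k) h) \<longlonglongrightarrow> integral\<^sup>L N h"
    proof (rule weak_conv_imp_integral_bdd_continuous_conv[OF _ N conv])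
      show "real_distribution ((\<nu> \<circ> id \<circ> r) n)" for n
        unfolding \<nu>_def comp_def by (rule real_distribution_measure_pmf)
      show "isCont h x" for x using hc by (simp add: continuous_on_eq_continuous_at)
      show "norm (h x) \<le> B" for x using B by (simp add: h_def)
    qed
    moreover have "integral\<^sup>L ((\<nu> \<circ> id \<circ> r) k) h = measure_pmf.expectation (p (r k)) u" for k
      using borel_measurable_continuous_onI[OF hc] \<sigma>
      by (simp add: \<nu>_def integral_distr h_def)
    moreover have "integral\<^sup>L \<mu> u = integral\<^sup>L N h"
    proof -
      have "integral\<^sup>L \<mu> u = integral\<^sup>L (density N (\<lambda>s. ennreal (indicat_real A s))) (\<lambda>s. u (T s))"
        unfolding \<mu>_def using um T by (subst integral_distr) (auto simp: ennreal_indicator)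
      also have "\<dots> = integral\<^sup>L N (\<lambda>s. indicat_real A s *\<^sub>R u (T s))"
        using um T A by (subst integral_density) auto
      also have "(\<lambda>s. indicat_real A s *\<^sub>R u (T s)) = h"
        by (auto simp: h_def T_def A_def)
      finally show ?thesis .
    qed
    ultimately show "(\<lambda>k. measure_pmf.expectation (p (r k)) u) \<longlonglongrightarrow> integral\<^sup>L \<mu> u" by simp
  qed
qed

subsection \<open>Duality\<close>

lemma C0_borel_measurable: "u \<in> C0 \<Longrightarrow> u \<in> borel_measurable borel"
  by (auto simp: C0_def intro: borel_measurable_continuous_onI)

section \<open>Coverings on finite sets of points\<close>

text \<open>Point masses \<open>r x / B\<close> at the points of \<open>F\<close> are admissible in
  the supremum, because \<open>reflect g (t - x) = g (x - t)\<close>.\<close>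

lemma M1_ge_finite_sum:
  fixes f g :: "'a::euclidean_space \<Rightarrow> real"
  assumes f: "f \<in> borel_measurable borel" and g: "g \<in> borel_measurable borel"
    and f0: "\<And>x. 0 \<le> f x" and g0: "\<And>x. 0 \<le> g x"
    and fin: "finite F" and r0: "\<And>x. x \<in> F \<Longrightarrow> 0 \<le> r x" and B: "0 < B"
    and bound: "\<And>t. (\<Sum>x\<in>F. r x * g (x - t)) \<le> B"
  shows "ennreal ((\<Sum>x\<in>F. r x * f x) / B) \<le> M1 f (reflect g)"
proof -
  define \<rho> where "\<rho> = distr (point_measure F (\<lambda>x. ennreal (r x / B))) borel (\<lambda>x. x)"
  have nn: "(\<integral>\<^sup>+x. ennreal (h x) \<partial>\<rho>) = ennreal ((\<Sum>x\<in>F. r x * h x) / B)"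
    if h: "h \<in> borel_measurable borel" and h0: "\<And>x. 0 \<le> h x" for h
  proof -
    have "(\<integral>\<^sup>+x. ennreal (h x) \<partial>\<rho>) = (\<Sum>x\<in>F. ennreal (r x / B) * ennreal (h x))"
      unfolding \<rho>_def using h fin
      by (subst nn_integral_distr) (auto simp: nn_integral_point_measure_finite)
    also have "\<dots> = (\<Sum>x\<in>F. ennreal (r x / B * h x))"
      using r0 h0 B by (intro sum.cong refl ennreal_mult[symmetric]) auto
    also have "\<dots> = ennreal (\<Sum>x\<in>F. r x / B * h x)"
      using r0 h0 B by (intro sum_ennreal) auto
    finally show ?thesis by (simp add: sum_divide_distrib)
  qed
  have "measure_conv \<rho> (reflect g) t \<le> 1" for t
  proof -
    have "measure_conv \<rho> (reflect g) t = ennreal ((\<Sum>x\<in>F. r x * g (x - t)) / B)"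
      unfolding measure_conv_def reflect_def using g g0 by (simp add: nn)
    also have "\<dots> \<le> ennreal 1"
      using bound[of t] B by (intro ennreal_leI) simp
    finally show ?thesis by simp
  qed
  then have "\<rho> \<in> {\<rho> \<in> borel_measures. \<forall>x. measure_conv \<rho> (reflect g) x \<le> 1}"
    by (simp add: borel_measures_def \<rho>_def)
  then show ?thesis
    unfolding M1_def nn[OF f f0, symmetric] by (rule SUP_upper)
qed

text \<open>The variation used below: a fraction \<open>e\<close> of the mass of \<open>p\<close> is
  moved to the point \<open>t\<close>.\<close>

lemma expectation_mixture_pmf:
  fixes h :: "'a \<Rightarrow> real"
  assumes e: "0 \<le> e" "e \<le> 1" and h0: "\<And>x. 0 \<le> h x" and hB: "\<And>x. h x \<le> B"
  shows "measure_pmf.expectation (bernoulli_pmf e \<bind> (\<lambda>b. if b then return_pmf t else p)) h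
    = e * h t + (1 - e) * measure_pmf.expectation p h"
proof -
  let ?q = "bernoulli_pmf e \<bind> (\<lambda>b. if b then return_pmf t else p)"
  have int: "integrable (measure_pmf s) h" for s
    using h0 hB by (intro measure_pmf.integrable_const_bound[where B = B]) auto
  have nn: "(\<integral>\<^sup>+x. ennreal (h x) \<partial>measure_pmf s) = ennreal (measure_pmf.expectation s h)" for s
    by (rule nn_integral_eq_integral[OF int]) (simp add: h0)
  have E0: "0 \<le> measure_pmf.expectation s h" for s
    using h0 by simp
  have "ennreal (measure_pmf.expectation ?q h)
      = ennreal (h t) * ennreal e + ennreal (measure_pmf.expectation p h) * ennreal (1 - e)"
    unfolding nn[symmetric] using e by (simp add: nn_integral_bernoulli_pmf)
  also have "\<dots> = ennreal (e * h t + (1 - e) * measure_pmf.expectation p h)"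
    using e h0 E0 by (simp add: ennreal_mult[symmetric] ennreal_plus[symmetric] mult.commute del: ennreal_plus)
  finally show ?thesis
    using e h0 E0 by (subst (asm) ennreal_inj) auto
qed

text \<open>A second-order Taylor bound: the squared positive part has derivative
  \<open>2 * max 0 a\<close>, and its quadratic remainder is at most
  \<open>b\<^sup>2\<close>.\<close>

lemma max0_add_square_le:
  fixes a b :: real
  shows "(max 0 (a + b))\<^sup>2 \<le> (max 0 a)\<^sup>2 + 2 * max 0 a * b + b\<^sup>2"
proof (cases "a + b \<le> 0")
  case True
  have "0 \<le> (max 0 a + b)\<^sup>2" by simp
  then show ?thesis using True by (simp add: power2_sum max_def)
next
  case False
  show ?thesis
  proof (cases "0 \<le> a")
    case True
    then show ?thesis using False by (simp add: power2_sum)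
  next
    case neg: False
    then have "(a + b)\<^sup>2 \<le> b\<^sup>2" using False by (intro power_mono) auto
    then show ?thesis using False neg by simp
  qed
qed

text \<open>The first-order condition at a near-minimizer \<open>p\<close> of the squared violation \<open>J\<close>, tested against
  moving a small mass to \<open>t\<close>, says that the residuals \<open>r p\<close> are, up to the normalisation \<open>D\<close>, the
  weights of an admissible measure for \<open>M1\<close>.\<close>

lemma approximate_cover:
  fixes f g :: "'a::euclidean_space \<Rightarrow> real"
  assumes f: "f \<in> C0" and g: "g \<in> C0"
    and f0: "\<And>x. 0 \<le> f x" and g0: "\<And>x. 0 \<le> g x"
    and fin: "finite F" and c: "0 < c" "M1 f (reflect g) < ennreal c" and "0 < \<eta>"
  shows "\<exists>p. \<forall>x\<in>F. f x \<le> c * measure_pmf.expectation p (\<lambda>t. g (x - t)) + \<eta>"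
proof (rule ccontr)
  assume none: "\<not> ?thesis"
  obtain B where B: "0 \<le> B" "\<And>x. \<bar>g x\<bar> \<le> B"
    using C0_bounded[OF g] by blast
  have gB: "g x \<le> B" for x using B(2)[of x] by simp
  define v where "v p x = measure_pmf.expectation p (\<lambda>t. g (x - t))" for p x
  have int: "integrable (measure_pmf p) (\<lambda>t. g (x - t))" for p x
    using B by (intro measure_pmf.integrable_const_bound[where B = B]) auto
  have v0: "0 \<le> v p x" for p x using g0 by (simp add: v_def)
  have vB: "v p x \<le> B" for p x
    unfolding v_def using measure_pmf.integral_le_const[OF int[of p x], of B] gB by simp
  define r where "r p x = max 0 (f x - c * v p x)" for p x
  define J where "J p = (\<Sum>x\<in>F. (r p x)\<^sup>2)" for p
  have J_ge: "\<eta>\<^sup>2 \<le> J p" for p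
  proof -
    obtain x where x: "x \<in> F" "f x > c * v p x + \<eta>"
      using none by (auto simp: v_def not_le)
    then have "\<eta>\<^sup>2 \<le> (r p x)\<^sup>2"
      using \<open>0 < \<eta>\<close> by (intro power_mono) (auto simp: r_def)
    also have "\<dots> \<le> J p"
      unfolding J_def using x fin by (intro member_le_sum) auto
    finally show ?thesis .
  qed
  \<comment> \<open>\<open>e\<^sup>2 * K\<close> bounds the second-order term of a variation of size
    \<open>e\<close>; \<open>e\<close> is chosen so that all errors together stay below the lower
    bound \<open>\<eta>\<^sup>2\<close> of \<open>J\<close>.\<close>
  define K where "K = c\<^sup>2 * (real (card F) * B\<^sup>2)"
  have K0: "0 \<le> K" by (simp add: K_def)
  define e where "e = min 1 (\<eta>\<^sup>2 / (1 + K))"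
  have e: "0 < e" "e \<le> 1" using \<open>0 < \<eta>\<close> K0 by (auto simp: e_def add_pos_nonneg)
  have eK: "e * (1 + K) \<le> \<eta>\<^sup>2"
    using K0 by (subst pos_le_divide_eq[symmetric]) (auto simp: e_def)
  have bdd: "bdd_below (range J)" using J_ge by (intro bdd_belowI2) auto
  \<comment> \<open>An exact minimizer may fail to exist. The slack \<open>e\<^sup>2\<close> is of
    the order of the quadratic remainder, so after division by \<open>e\<close> it remains a small
    error.\<close>
  obtain p where p: "J p < (INF p. J p) + e\<^sup>2"
    using cINF_less_iff[OF _ bdd, of "(INF p. J p) + e\<^sup>2"] e by auto
  define A where "A = (\<Sum>x\<in>F. r p x * v p x)"
  define D where "D = A + e * (1 + K) / (2 * c)"
  have r0: "0 \<le> r p x" for x by (simp add: r_def)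
  have "0 \<le> A" unfolding A_def using r0 v0 by (intro sum_nonneg) auto
  then have D: "0 < D" using e K0 c by (simp add: D_def add_nonneg_pos)
  have bound: "(\<Sum>x\<in>F. r p x * g (x - t)) \<le> D" for t
  proof -
    define q where "q = bernoulli_pmf e \<bind> (\<lambda>b. if b then return_pmf t else p)"
    define d where "d x = g (x - t) - v p x" for x
    have vq: "v q x = v p x + e * d x" for x
      unfolding v_def d_def q_def
      using e g0 gB by (subst expectation_mixture_pmf[where B = B]) (auto simp: algebra_simps)
    have d2: "(d x)\<^sup>2 \<le> B\<^sup>2" for x
      using g0[of "x - t"] gB[of "x - t"] v0[of p x] vB[of p x] B(1)
      by (intro abs_le_square_iff[THEN iffD1]) (auto simp: d_def)
    have "(INF p. J p) \<le> J q" by (rule cINF_lower[OF bdd]) simp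
    also have "J q \<le> (\<Sum>x\<in>F. (r p x)\<^sup>2 + 2 * r p x * (- c * e * d x) + (- c * e * d x)\<^sup>2)"
      unfolding J_def
    proof (rule sum_mono)
      fix x
      have "r q x = max 0 ((f x - c * v p x) + (- c * e * d x))"
        by (simp add: r_def vq algebra_simps)
      then show "(r q x)\<^sup>2 \<le> (r p x)\<^sup>2 + 2 * r p x * (- c * e * d x) + (- c * e * d x)\<^sup>2"
        unfolding r_def using max0_add_square_le by metis
    qed
    also have "\<dots> = J p - 2 * c * e * (\<Sum>x\<in>F. r p x * d x) + e\<^sup>2 * c\<^sup>2 * (\<Sum>x\<in>F. (d x)\<^sup>2)"
      unfolding J_def sum.distrib sum_distrib_left sum_negf[symmetric] diff_conv_add_uminus
      by (intro arg_cong2[where f = "(+)"] sum.cong) (auto simp: power_mult_distrib)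
    also have "e\<^sup>2 * c\<^sup>2 * (\<Sum>x\<in>F. (d x)\<^sup>2) \<le> e\<^sup>2 * c\<^sup>2 * (\<Sum>x\<in>F. B\<^sup>2)"
      using d2 by (intro mult_left_mono sum_mono) auto
    also have "\<dots> = e\<^sup>2 * K" by (simp add: K_def)
    finally have "e * (2 * c * (\<Sum>x\<in>F. r p x * d x)) \<le> e * (e * (1 + K))"
      using p by (simp add: power2_eq_square algebra_simps)
    then have "2 * c * (\<Sum>x\<in>F. r p x * d x) \<le> e * (1 + K)"
      using e by simp
    moreover have "(\<Sum>x\<in>F. r p x * d x) = (\<Sum>x\<in>F. r p x * g (x - t)) - A"
      by (simp add: d_def A_def right_diff_distrib sum_subtractf)
    ultimately have "2 * c * ((\<Sum>x\<in>F. r p x * g (x - t)) - A) \<le> e * (1 + K)" by simp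
    then show ?thesis
      using c by (simp add: D_def field_simps)
  qed
  \<comment> \<open>The residual vanishes wherever \<open>f x \<le> c * v p x\<close>, so
    \<open>r p x\<close> times \<open>f x - c * v p x\<close> is its square. The term
    \<open>J p \<ge> \<eta>\<^sup>2\<close> then outweighs the excess of \<open>c * D\<close> over
    \<open>c * A\<close>.\<close>
  have "(\<Sum>x\<in>F. r p x * f x) = J p + c * A"
  proof -
    have "r p x * f x = (r p x)\<^sup>2 + c * (r p x * v p x)" for x
      by (auto simp: r_def max_def power2_eq_square algebra_simps)
    then show ?thesis
      by (simp add: J_def A_def sum.distrib sum_distrib_left)
  qed
  moreover have "c * D = c * A + e * (1 + K) / 2"
    using c by (simp add: D_def field_simps)
  moreover have "e * (1 + K) / 2 < \<eta>\<^sup>2"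
    using eK \<open>0 < \<eta>\<close> zero_less_power[of \<eta> 2] by linarith
  ultimately have "c * D < (\<Sum>x\<in>F. r p x * f x)" using J_ge[of p] by simp
  then have "c \<le> (\<Sum>x\<in>F. r p x * f x) / D" using D by (simp add: field_simps)
  then have "ennreal c \<le> ennreal ((\<Sum>x\<in>F. r p x * f x) / D)" by (rule ennreal_leI)
  also have "\<dots> \<le> M1 f (reflect g)"
    using f g by (intro M1_ge_finite_sum fin D bound C0_borel_measurable f0 g0 r0)
  finally show False using c by simp
qed

section \<open>Weak duality\<close>

text \<open>\<open>g\<close> exceeds \<open>g a / 2\<close> on a ball around \<open>a\<close>, so
  the constraint at \<open>s - a\<close> bounds the mass of \<open>ball s d\<close> by
  \<open>2 / g a\<close>. Countably many such balls cover the space.\<close>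

lemma sigma_finite_of_conv_le:
  fixes g :: "'a::euclidean_space \<Rightarrow> real"
  assumes g: "continuous_on UNIV g" "0 < g a"
    and \<rho>: "sets \<rho> = sets borel" "\<And>x. measure_conv \<rho> (reflect g) x \<le> 1"
  shows "sigma_finite_measure \<rho>"
proof -
  define U where "U = {y. g a / 2 < g y}"
  have "open U" unfolding U_def using g(1) by (intro open_Collect_less continuous_intros)
  moreover have "a \<in> U" using g by (simp add: U_def)
  ultimately obtain d where d: "0 < d" "ball a d \<subseteq> U" by (meson open_contains_ball)
  obtain S :: "'a set" where S: "countable S" "\<And>X. open X \<Longrightarrow> X \<noteq> {} \<Longrightarrow> \<exists>s\<in>S. s \<in> X"
    using countable_dense_setE by blast
  have fin: "emeasure \<rho> (ball s d) \<noteq> \<infinity>" for s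
  proof -
    have "ennreal (g a / 2) * emeasure \<rho> (ball s d) = (\<integral>\<^sup>+y. ennreal (g a / 2) * indicator (ball s d) y \<partial>\<rho>)"
      using \<rho> by (subst nn_integral_cmult_indicator) auto
    also have "\<dots> \<le> (\<integral>\<^sup>+y. ennreal (reflect g ((s - a) - y)) \<partial>\<rho>)"
    proof (rule nn_integral_mono)
      fix y
      have "y - s + a \<in> U" if "y \<in> ball s d"
        using that d(2) by (auto simp: dist_norm norm_minus_commute algebra_simps subset_iff)
      then show "ennreal (g a / 2) * indicator (ball s d) y \<le> ennreal (reflect g ((s - a) - y))"
        by (auto simp: reflect_def U_def indicator_def algebra_simps intro!: ennreal_leI)
    qed
    also have "\<dots> \<le> 1" using \<rho>(2)[of "s - a"] by (simp add: measure_conv_def)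
    finally show ?thesis using g(2) by (auto simp: ennreal_mult_eq_top_iff ennreal_mult_top top_unique)
  qed
  show ?thesis
  proof
    have "\<exists>s\<in>S. x \<in> ball s d" for x
      using S(2)[of "ball x d"] d(1) by (auto simp: dist_commute)
    then show "\<exists>A. countable A \<and> A \<subseteq> sets \<rho> \<and> \<Union> A = space \<rho> \<and> (\<forall>a\<in>A. emeasure \<rho> a \<noteq> \<infinity>)"
      using S(1) \<rho>(1) sets_eq_imp_space_eq[OF \<rho>(1)] fin
      by (intro exI[of _ "(\<lambda>s. ball s d) ` S"]) auto
  qed
qed

text \<open>Convolution with \<open>g\<close> and with \<open>reflect g\<close> are adjoint:
  integrating the covering inequality against \<open>\<rho>\<close> and exchanging the integrals
  leaves an integrand at most 1 under \<open>\<mu>\<close>. A covering of infinite mass satisfies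
  the bound trivially.\<close>

lemma weak_duality:
  fixes f g :: "'a::euclidean_space \<Rightarrow> real"
  assumes g: "continuous_on UNIV g" "\<And>x. 0 \<le> g x" "g a \<noteq> 0"
  shows "M1 f (reflect g) \<le> N1 f g"
  unfolding M1_def N1_def
proof (intro SUP_least INF_greatest)
  fix \<rho> \<mu> :: "'a measure"
  assume "\<rho> \<in> {\<rho> \<in> borel_measures. \<forall>x. measure_conv \<rho> (reflect g) x \<le> 1}"
    and "\<mu> \<in> {\<mu> \<in> borel_measures. \<forall>x. ennreal (f x) \<le> measure_conv \<mu> g x}"
  then have \<rho>: "sets \<rho> = sets borel" "\<And>x. measure_conv \<rho> (reflect g) x \<le> 1"
    and \<mu>: "sets \<mu> = sets borel" "\<And>x. ennreal (f x) \<le> measure_conv \<mu> g x"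
    by (auto simp: borel_measures_def)
  have space: "space \<mu> = UNIV" "space \<rho> = UNIV"
    using sets_eq_imp_space_eq[OF \<mu>(1)] sets_eq_imp_space_eq[OF \<rho>(1)] by auto
  show "(\<integral>\<^sup>+x. ennreal (f x) \<partial>\<rho>) \<le> emeasure \<mu> UNIV"
  proof (cases "emeasure \<mu> UNIV = \<infinity>")
    case False
    interpret \<mu>: finite_measure \<mu>
      using False space by (intro finite_measureI) simp
    interpret \<rho>: sigma_finite_measure \<rho>
      using g(2)[of a] g(3) by (intro sigma_finite_of_conv_le[OF g(1) _ \<rho>, of a]) simp
    interpret P: pair_sigma_finite \<mu> \<rho> ..
    note [measurable_cong] = \<mu>(1) \<rho>(1)
    have gm [measurable]: "g \<in> borel_measurable borel"
      using g(1) by (rule borel_measurable_continuous_onI)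
    have "(\<integral>\<^sup>+x. ennreal (f x) \<partial>\<rho>) \<le> (\<integral>\<^sup>+x. \<integral>\<^sup>+t. ennreal (g (x - t)) \<partial>\<mu> \<partial>\<rho>)"
      using \<mu>(2) by (intro nn_integral_mono) (simp add: measure_conv_def)
    also have "\<dots> = (\<integral>\<^sup>+t. \<integral>\<^sup>+x. ennreal (g (x - t)) \<partial>\<rho> \<partial>\<mu>)"
      by (rule P.Fubini') measurable
    also have "\<dots> \<le> (\<integral>\<^sup>+t. 1 \<partial>\<mu>)"
      using \<rho>(2) by (intro nn_integral_mono) (simp add: measure_conv_def reflect_def)
    finally show ?thesis by (simp add: space)
  qed simp
qed

section \<open>Passage to the limit and the optimal covering\<close>

text \<open>Dominated convergence with a constant bound. Continuity later extends the covering
  inequality from a dense set to all points.\<close>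

lemma continuous_on_conv_integral:
  fixes g :: "'a::euclidean_space \<Rightarrow> real"
  assumes "finite_measure \<mu>" "sets \<mu> = sets borel" and g: "g \<in> C0"
  shows "continuous_on UNIV (\<lambda>x. \<integral>t. g (x - t) \<partial>\<mu>)"
proof -
  interpret finite_measure \<mu> by fact
  note [measurable_cong] = assms(2)
  have [measurable]: "g \<in> borel_measurable borel" using g by (rule C0_borel_measurable)
  have gc: "continuous_on UNIV g" using g by (simp add: C0_def)
  obtain B where B: "\<And>x. \<bar>g x\<bar> \<le> B" using C0_bounded[OF g] by blast
  have "(\<lambda>k. \<integral>t. g (X k - t) \<partial>\<mu>) \<longlonglongrightarrow> (\<integral>t. g (x - t) \<partial>\<mu>)" if X: "X \<longlonglongrightarrow> x" for X x
  proof (rule integral_dominated_convergence[where w = "\<lambda>_. B"])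
    show "AE t in \<mu>. (\<lambda>k. g (X k - t)) \<longlonglongrightarrow> g (x - t)"
      using X by (auto intro!: continuous_on_tendsto_compose[OF gc] tendsto_intros)
  qed (use B in auto)
  then show ?thesis
    by (auto simp: continuous_on_sequentially comp_def)
qed

lemma cover_of_M1_mass:
  fixes f g :: "'a::euclidean_space \<Rightarrow> real"
  assumes f: "f \<in> C0" and g: "g \<in> C0"
    and f0: "\<And>x. 0 \<le> f x" and g0: "\<And>x. 0 \<le> g x" and fin: "M1 f (reflect g) < \<infinity>"
  obtains \<mu> where "sets \<mu> = sets borel" "emeasure \<mu> UNIV \<le> M1 f (reflect g)"
    "\<And>x. ennreal (f x) \<le> measure_conv \<mu> g x"
proof -
  define m where "m = enn2real (M1 f (reflect g))"
  have m: "0 \<le> m" "M1 f (reflect g) = ennreal m"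
    using fin by (auto simp: m_def)
  obtain S :: "'a set" where S: "countable S" "\<And>X. open X \<Longrightarrow> X \<noteq> {} \<Longrightarrow> \<exists>s\<in>S. s \<in> X"
    using countable_dense_setE by blast
  have "S \<noteq> {}" using S(2)[of UNIV] by auto
  \<comment> \<open>The increment keeps \<open>c k\<close> positive and strictly above
    \<open>M1 f (reflect g)\<close>, as \<open>approximate_cover\<close> demands, even if
    \<open>m = 0\<close>.\<close>
  define c where "c k = m + inverse (real (Suc k))" for k
  have "\<exists>p. \<forall>x\<in>from_nat_into S ` {..k}.
      f x \<le> c k * measure_pmf.expectation p (\<lambda>t. g (x - t)) + inverse (real (Suc k))" for k
    using m by (intro approximate_cover f g f0 g0) (auto simp: c_def ennreal_less_iff intro: add_nonneg_pos)
  then obtain p where p: "\<And>k x. x \<in> from_nat_into S ` {..k} \<Longrightarrow>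
      f x \<le> c k * measure_pmf.expectation (p k) (\<lambda>t. g (x - t)) + inverse (real (Suc k))"
    by metis
  obtain r and \<mu> :: "'a measure" where r: "strict_mono r"
    and \<mu>: "sets \<mu> = sets borel" "emeasure \<mu> UNIV \<le> 1"
    and lim: "\<And>u. u \<in> C0 \<Longrightarrow> (\<lambda>k. measure_pmf.expectation (p (r k)) u) \<longlonglongrightarrow> integral\<^sup>L \<mu> u"
    using vague_compactness_pmf[of p] by blast
  have space: "space \<mu> = UNIV" using sets_eq_imp_space_eq[OF \<mu>(1)] by simp
  interpret \<mu>: finite_measure \<mu>
    using \<mu>(2) space by (intro finite_measureI) (auto simp: top_unique)
  note [measurable_cong] = \<mu>(1)
  have [measurable]: "g \<in> borel_measurable borel" using g by (rule C0_borel_measurable)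
  define G where "G x = (\<integral>t. g (x - t) \<partial>\<mu>)" for x
  have S_le: "f x \<le> m * G x" if x: "x \<in> S" for x
  proof -
    obtain j where j: "x = from_nat_into S j"
      using from_nat_into_surj[OF S(1) x] by metis
    have inv: "(\<lambda>k. inverse (real (Suc (r k)))) \<longlonglongrightarrow> 0"
      using LIMSEQ_subseq_LIMSEQ[OF LIMSEQ_inverse_real_of_nat r] by (simp add: comp_def)
    have "(\<lambda>k. c (r k) * measure_pmf.expectation (p (r k)) (\<lambda>t. g (x - t)) + inverse (real (Suc (r k))))
        \<longlonglongrightarrow> (m + 0) * G x + 0"
      unfolding c_def G_def by (intro tendsto_intros inv lim C0_translate_reflect g)
    \<comment> \<open>The \<open>j\<close>-th point belongs to every finite set from index
      \<open>j\<close> on, and \<open>k \<le> r k\<close>.\<close>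
    moreover have "f x \<le> c (r k) * measure_pmf.expectation (p (r k)) (\<lambda>t. g (x - t)) + inverse (real (Suc (r k)))"
      if "j \<le> k" for k
      using that seq_suble[OF r, of k] by (intro p) (auto simp: j)
    ultimately show ?thesis
      using LIMSEQ_le_const[of _ "(m + 0) * G x + 0" "f x"] by auto
  qed
  \<comment> \<open>A nonempty open set of uncovered points would meet the dense set
    \<open>S\<close>.\<close>
  have "open {x. m * G x < f x}"
    unfolding G_def using f
    by (intro open_Collect_less continuous_intros continuous_on_conv_integral g \<mu>(1) \<mu>.finite_measure_axioms)
       (auto simp: C0_def)
  then have le: "f x \<le> m * G x" for x
    using S(2)[of "{x. m * G x < f x}"] S_le by (force simp: not_le[symmetric])
  obtain B where B: "\<And>x. \<bar>g x\<bar> \<le> B" using C0_bounded[OF g] by blast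
  have nn: "(\<integral>\<^sup>+t. ennreal (g (x - t)) \<partial>\<mu>) = ennreal (G x)" for x
    unfolding G_def using B g0
    by (intro nn_integral_eq_integral \<mu>.integrable_const_bound[where B = B]) auto
  show ?thesis
  proof
    show "sets (scale_measure (ennreal m) \<mu>) = sets borel" using \<mu>(1) by simp
    show "emeasure (scale_measure (ennreal m) \<mu>) UNIV \<le> M1 f (reflect g)"
      using mult_left_mono[OF \<mu>(2), of "ennreal m"] by (simp add: m(2))
    have "measure_conv (scale_measure (ennreal m) \<mu>) g x = ennreal (m * G x)" for x
      unfolding measure_conv_def using m(1) by (simp add: nn_integral_scale_measure nn ennreal_mult')
    then show "ennreal (f x) \<le> measure_conv (scale_measure (ennreal m) \<mu>) g x" for x
      using le by (simp add: ennreal_leI)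
  qed
qed

theorem theorem1p2:
  fixes f g :: "real ^ 'n \<Rightarrow> real"
  assumes "f \<in> C0" and "g \<in> C0"
    and "\<forall>x. 0 \<le> f x" and "\<forall>x. 0 \<le> g x"
    and "\<exists>x. f x \<noteq> 0" and "\<exists>x. g x \<noteq> 0"
    and "\<exists>\<mu> \<in> borel_measures. finite_measure \<mu> \<and> regular_measure \<mu> \<and>
           (\<forall>x. ennreal (f x) \<le> measure_conv \<mu> g x)"
  shows "M1 f (reflect g) = N1 f g \<and>
         (\<exists>\<mu>\<^sub>0 \<in> borel_measures. (\<forall>x. ennreal (f x) \<le> measure_conv \<mu>\<^sub>0 g x) \<and>
            emeasure \<mu>\<^sub>0 UNIV = N1 f g)"
proof -
  have N1_le: "N1 f g \<le> emeasure \<mu> UNIV"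
    if "\<mu> \<in> borel_measures" "\<forall>x. ennreal (f x) \<le> measure_conv \<mu> g x" for \<mu>
    unfolding N1_def using that by (intro INF_lower) simp
  have weak: "M1 f (reflect g) \<le> N1 f g"
    using assms(2,4,6) by (auto simp: C0_def intro: weak_duality)
  obtain \<mu> where "\<mu> \<in> borel_measures" "finite_measure \<mu>" "\<forall>x. ennreal (f x) \<le> measure_conv \<mu> g x"
    using assms(7) by blast
  \<comment> \<open>Finiteness passes to \<open>M1 f (reflect g)\<close> by weak duality, as
    \<open>cover_of_M1_mass\<close> requires. The mass of the resulting covering lies between
    \<open>N1 f g\<close> and \<open>M1 f (reflect g)\<close>, which forces equality
    throughout.\<close>
  then have "N1 f g < \<infinity>"
    using N1_le[of \<mu>] finite_measure.emeasure_finite[of \<mu> UNIV] by (auto simp: less_top top_unique)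
  then obtain \<mu>\<^sub>0 where \<mu>\<^sub>0: "sets \<mu>\<^sub>0 = sets borel" "emeasure \<mu>\<^sub>0 UNIV \<le> M1 f (reflect g)"
    "\<And>x. ennreal (f x) \<le> measure_conv \<mu>\<^sub>0 g x"
    using cover_of_M1_mass[of f g] assms(1-4) weak by (metis order_le_less_trans)
  then have "\<mu>\<^sub>0 \<in> borel_measures" by (simp add: borel_measures_def)
  with \<mu>\<^sub>0 N1_le[of \<mu>\<^sub>0] weak show ?thesis by (auto intro: antisym order_trans)
qed

end
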